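(* Let $n\ge2$ and let $(X,w)$ be a Euclidean $4$-design in $\mathbb R^n$ supported by two concentric spheres, $X=X_1\cup X_2$ with $X_i\subset S^{n-1}(r_i)$, such that $0\notin X$, $w$ is constant on each $X_i$, and $s_{\lambda,\mu}\le2$ for all $\lambda,\mu\in\{1,2\}$. If $|X_1|=n+1$, then $(X,w)$ is a tight Euclidean $4$-design.
   Context: A weighted finite set $(X,w)$: finite $X\subset\mathbb R^n$, $w:X\to\mathbb R_{>0}$; "supported by two concentric spheres" means $X=X_1\cup X_2$ disjoint nonempty with $X_i\subset S_i=S^{n-1}(r_i)$, the sphere of radius $r_i\ge0$ centred at the origin, $r_1\ne r_2$. $(X,w)$ is a Euclidean $t$-design if $\sum_{i}\frac{w(X_i)}{|S_i|}\int_{S_i}f\,d\sigma_i=\sum_{\boldsymbol u\in X}w(\boldsymbol u)f(\boldsymbol u)$ for all polynomials $f$ of degree $\le t$ ($\sigma_i$ surface measure, $|S_i|=\sigma_i(S_i)$, $w(X_i)=\sum_{X_i}w$). $A(X_\lambda,X_\mu)=\{\frac{\boldsymbol x\cdot\boldsymbol y}{r_\lambda r_\mu}:\boldsymbol x\in X_\lambda,\boldsymbol y\in X_\mu,\boldsymbol x\ne\boldsymbol y\}$, $s_{\lambda,\mu}=|A(X_\lambda,X_\mu)|$. A Euclidean $4$-design is tight (a tight Euclidean $4$-design) if $|X|=\dim\mathcal P_2(S)=\binom{n+2}{2}$, where $S=S_1\cup S_2$ and $\mathcal P_2(S)$ is the space of restrictions to $S$ of polynomials of degree $\le2$. *)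

theory Defs
  imports "HOL-Analysis.Analysis" "HOL-Library.Function_Algebras"
begin

(* The surface measure of the sphere of radius r centred at the origin, as a Borel measure on the
   ambient space concentrated on that sphere.  For r > 0 it is the cone measure: the surface
   measure of A is n / r times the Lebesgue measure of the cone over A, that is, of the set
   {t *\<^sub>R x | x t. x \<in> A \<and> 0 < t \<and> t \<le> 1} (cf. emeasure_surface_measure below).
   The sphere of radius 0 is the single point 0; its measure is the unit point mass, so that the
   average of f over this sphere is f 0. *)
definition surface_measure :: "real \<Rightarrow> (real ^ 'n) measure" where
  "surface_measure r =
     (if r = 0 then distr (count_space {0}) borel (\<lambda>x. x)
      else scale_measure (ennreal (real CARD('n) / r))
             (distr (restrict_space lborel (cball 0 r)) borel (\<lambda>x. (r / norm x) *\<^sub>R x)))"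

lemma emeasure_surface_measure:
  fixes A :: "(real ^ 'n) set"
  assumes r: "r > 0" and A: "A \<in> sets borel" "A \<subseteq> sphere 0 r"
  shows "emeasure (surface_measure r) A =
           ennreal (real CARD('n) / r) * emeasure lborel {t *\<^sub>R x | x t. x \<in> A \<and> 0 < t \<and> t \<le> 1}"
proof -
  have cone: "(\<lambda>x. (r / norm x) *\<^sub>R x) -` A \<inter> cball 0 r
                = {t *\<^sub>R x | x t. x \<in> A \<and> 0 < t \<and> t \<le> 1}" (is "?L = ?R")
  proof
    show "?L \<subseteq> ?R"
    proof
      fix y assume y: "y \<in> ?L"
      then have "y \<noteq> 0" using A(2) r by auto
      then have "y = (norm y / r) *\<^sub>R ((r / norm y) *\<^sub>R y)" "0 < norm y / r" "norm y / r \<le> 1"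
        using r y by auto
      then show "y \<in> ?R" using y by blast
    qed
    show "?R \<subseteq> ?L"
    proof
      fix y assume "y \<in> ?R"
      then obtain x t where xt: "y = t *\<^sub>R x" "x \<in> A" "0 < t" "t \<le> 1" by blast
      moreover have "norm x = r" using A(2) xt(2) by auto
      ultimately show "y \<in> ?L" using r by (auto simp: mult_left_le_one_le)
    qed
  qed
  have m: "(\<lambda>x::real ^ 'n. (r / norm x) *\<^sub>R x) \<in> restrict_space lborel (cball 0 r) \<rightarrow>\<^sub>M borel"
    by (rule measurable_restrict_space1) measurable
  show ?thesis
    using r A(1) m by (simp add: surface_measure_def emeasure_distr space_restrict_space
        emeasure_restrict_space flip: cone)
qed

(* f is a polynomial function on n-space of degree at most d; a i is the exponent of the
   i-th coordinate. *)
definition poly_degree_le :: "nat \<Rightarrow> (real ^ 'n \<Rightarrow> real) \<Rightarrow> bool" where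
  "poly_degree_le d f \<longleftrightarrow>
     (\<exists>c :: ('n \<Rightarrow> nat) \<Rightarrow> real.
        f = (\<lambda>x. \<Sum>a\<in>{a. (\<Sum>i\<in>UNIV. a i) \<le> d}. c a * (\<Prod>i\<in>UNIV. (x $ i) ^ a i)))"

(* Restrictions to S are extended by 0 outside S, so that they form a linear subspace of the
   space of all real functions. *)
definition poly_space_on :: "nat \<Rightarrow> (real ^ 'n) set \<Rightarrow> (real ^ 'n \<Rightarrow> real) set" where
  "poly_space_on d S = {\<lambda>x. if x \<in> S then f x else 0 | f. poly_degree_le d f}"

global_interpretation fun_vs: vector_space "\<lambda>(c :: real) (f :: 'a \<Rightarrow> real) x. c * f x"
  by standard (auto simp: fun_eq_iff algebra_simps)

definition weighted_finite_set :: "(real ^ 'n) set \<Rightarrow> (real ^ 'n \<Rightarrow> real) \<Rightarrow> bool" where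
  "weighted_finite_set X w \<longleftrightarrow> finite X \<and> (\<forall>x\<in>X. w x > 0)"

(* Only the values Y 1, Y 2, r 1, r 2 of the families Y and r matter. *)
definition on_two_concentric_spheres ::
    "(real ^ 'n) set \<Rightarrow> (nat \<Rightarrow> (real ^ 'n) set) \<Rightarrow> (nat \<Rightarrow> real) \<Rightarrow> bool" where
  "on_two_concentric_spheres X Y r \<longleftrightarrow>
     X = Y 1 \<union> Y 2 \<and> Y 1 \<inter> Y 2 = {} \<and> r 1 \<noteq> r 2 \<and>
     (\<forall>i\<in>{1, 2}. Y i \<noteq> {} \<and> 0 \<le> r i \<and> Y i \<subseteq> sphere 0 (r i))"

definition euclidean_design ::
    "nat \<Rightarrow> (real ^ 'n) set \<Rightarrow> (real ^ 'n \<Rightarrow> real) \<Rightarrow> (nat \<Rightarrow> (real ^ 'n) set) \<Rightarrow> (nat \<Rightarrow> real) \<Rightarrow> bool"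
  where
  "euclidean_design t X w Y r \<longleftrightarrow>
     weighted_finite_set X w \<and> on_two_concentric_spheres X Y r \<and>
     (\<forall>f. poly_degree_le t f \<longrightarrow>
        (\<Sum>i\<in>{1, 2}. (\<Sum>u\<in>Y i. w u) / measure (surface_measure (r i)) (sphere (0 :: real ^ 'n) (r i)) *
            (LINT x:sphere 0 (r i)|surface_measure (r i). f x))
        = (\<Sum>u\<in>X. w u * f u))"

definition angle_set ::
    "(nat \<Rightarrow> (real ^ 'n) set) \<Rightarrow> (nat \<Rightarrow> real) \<Rightarrow> nat \<Rightarrow> nat \<Rightarrow> real set" where
  "angle_set Y r l m = {(x \<bullet> y) / (r l * r m) | x y. x \<in> Y l \<and> y \<in> Y m \<and> x \<noteq> y}"

definition tight_euclidean_4_design ::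
    "(real ^ 'n) set \<Rightarrow> (real ^ 'n \<Rightarrow> real) \<Rightarrow> (nat \<Rightarrow> (real ^ 'n) set) \<Rightarrow> (nat \<Rightarrow> real) \<Rightarrow> bool"
  where
  "tight_euclidean_4_design X w Y r \<longleftrightarrow>
     euclidean_design 4 X w Y r \<and>
     (let S = sphere 0 (r 1) \<union> sphere 0 (r 2) :: (real ^ 'n) set
      in card X = fun_vs.dim (poly_space_on 2 S) \<and>
         fun_vs.dim (poly_space_on 2 S) = (CARD('n) + 2) choose 2)"

end

theory Submission
  imports Defs
begin

text \<open>
  The lower bound on \<open>card X\<close> is Moeller's: the square of a polynomial of degree at most 2 vanishing on
  \<open>X\<close> integrates to 0 over both spheres, so restriction to \<open>X\<close> is injective on
  \<open>poly_space_on 2 S\<close>.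

  For the upper bound, write \<open>A = Y 1\<close>. Testing the design with \<open>f x * ((norm x)\<^sup>2 - (r 2)\<^sup>2)\<close> shows
  that \<open>A\<close> sums to 0 and spans the space. Since \<open>x \<bullet> y\<close> takes only two values for \<open>x \<in> A\<close>,
  \<open>y \<in> Y 2\<close>, the square of each linear form \<open>m x y = x \<bullet> y - c\<close> is an affine function of it on
  \<open>Y 2\<close>. Together with the constancy of \<open>\<Sum>x\<in>A. m x y\<close> this puts, for generic \<open>c\<close>, all quadratic
  functions on \<open>Y 2\<close> in the span of the products \<open>m x * m x'\<close> over 2-subsets of \<open>A\<close>. As \<open>Y 2\<close> is a
  two-distance set, every function on it is quadratic, so \<open>card (Y 2) \<le> (n + 1) choose 2\<close>,
  which makes the two bounds coincide.
\<close>

section \<open>Polynomials and the surface measure\<close>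

lemma poly_degree_le_add:
  assumes "poly_degree_le d f" "poly_degree_le d g"
  shows "poly_degree_le d (\<lambda>x. f x + g x)"
proof -
  let ?m = "\<lambda>(a::'a \<Rightarrow> nat) (x::real ^ 'a). \<Prod>i\<in>UNIV. (x $ i) ^ a i"
  obtain c c' where "f = (\<lambda>x. \<Sum>a\<in>{a. (\<Sum>i\<in>UNIV. a i) \<le> d}. c a * ?m a x)"
      "g = (\<lambda>x. \<Sum>a\<in>{a. (\<Sum>i\<in>UNIV. a i) \<le> d}. c' a * ?m a x)"
    using assms unfolding poly_degree_le_def by auto
  then show ?thesis
    unfolding poly_degree_le_def
    by (intro exI[of _ "\<lambda>a. c a + c' a"]) (simp add: sum.distrib algebra_simps)
qed

lemma poly_degree_le_scale:
  assumes "poly_degree_le d f"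
  shows "poly_degree_le d (\<lambda>x. k * f x)"
proof -
  let ?m = "\<lambda>(a::'a \<Rightarrow> nat) (x::real ^ 'a). \<Prod>i\<in>UNIV. (x $ i) ^ a i"
  obtain c where "f = (\<lambda>x. \<Sum>a\<in>{a. (\<Sum>i\<in>UNIV. a i) \<le> d}. c a * ?m a x)"
    using assms unfolding poly_degree_le_def by auto
  then show ?thesis
    unfolding poly_degree_le_def
    by (intro exI[of _ "\<lambda>a. k * c a"]) (simp add: sum_distrib_left algebra_simps)
qed

text \<open>Each exponent is bounded by the total degree. Without finiteness the sums in
  \<open>poly_degree_le\<close> would collapse to the default value 0.\<close>

lemma finite_exponents: "finite {a :: 'n::finite \<Rightarrow> nat. (\<Sum>i\<in>UNIV. a i) \<le> d}"
proof (rule finite_subset)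
  show "{a :: 'n \<Rightarrow> nat. (\<Sum>i\<in>UNIV. a i) \<le> d} \<subseteq> (UNIV :: 'n set) \<rightarrow>\<^sub>E {..d}"
  proof
    fix a :: "'n \<Rightarrow> nat"
    assume "a \<in> {a. (\<Sum>i\<in>UNIV. a i) \<le> d}"
    then have "a i \<le> d" for i
      using member_le_sum[of i UNIV a] by simp
    then show "a \<in> UNIV \<rightarrow>\<^sub>E {..d}"
      by (simp add: PiE_UNIV_domain)
  qed
qed (simp add: finite_PiE)

lemma poly_degree_le_monomial:
  fixes a :: "'n::finite \<Rightarrow> nat"
  assumes "(\<Sum>i\<in>UNIV. a i) \<le> d"
  shows "poly_degree_le d (\<lambda>x. \<Prod>i\<in>UNIV. (x $ i) ^ a i)"
  unfolding poly_degree_le_def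
proof (intro exI[of _ "\<lambda>b. if b = a then 1 else 0"] ext)
  fix x :: "real ^ 'n"
  have "(\<Sum>b\<in>{b. (\<Sum>i\<in>UNIV. b i) \<le> d}. (if b = a then 1 else 0) * (\<Prod>i\<in>UNIV. (x $ i) ^ b i))
      = (\<Sum>b\<in>{b. (\<Sum>i\<in>UNIV. b i) \<le> d}. if a = b then (\<Prod>i\<in>UNIV. (x $ i) ^ b i) else 0)"
    by (rule sum.cong) auto
  also have "\<dots> = (\<Prod>i\<in>UNIV. (x $ i) ^ a i)"
    using assms by (subst sum.delta'[OF finite_exponents]) auto
  finally show "(\<Prod>i\<in>UNIV. (x $ i) ^ a i) =
      (\<Sum>b\<in>{b. (\<Sum>i\<in>UNIV. b i) \<le> d}. (if b = a then 1 else 0) * (\<Prod>i\<in>UNIV. (x $ i) ^ b i))"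
    by simp
qed

lemma poly_degree_le_const: "poly_degree_le d (\<lambda>x. k)"
  using poly_degree_le_scale[OF poly_degree_le_monomial[of "\<lambda>_. 0" d], of k] by simp

lemma poly_degree_le_nth:
  assumes "d \<ge> 1"
  shows "poly_degree_le d (\<lambda>x :: real ^ 'n. x $ i)"
proof -
  have "(\<Prod>j\<in>UNIV. (x $ j) ^ (if j = i then 1 else 0)) = x $ i" for x :: "real ^ 'n"
    by (simp add: if_distrib[of "\<lambda>k. _ ^ k"] cong: if_cong)
  then show ?thesis
    using poly_degree_le_monomial[of "\<lambda>j. if j = i then 1 else 0" d] assms by simp
qed

lemma poly_degree_le_sum:
  assumes "\<And>i. i \<in> I \<Longrightarrow> poly_degree_le d (f i)"
  shows "poly_degree_le d (\<lambda>x. \<Sum>i\<in>I. f i x)"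
  using assms
  by (induction I rule: infinite_finite_induct) (auto intro: poly_degree_le_const poly_degree_le_add)

lemma poly_degree_le_mult:
  assumes "poly_degree_le d f" "poly_degree_le e g"
  shows "poly_degree_le (d + e) (\<lambda>x. f x * g x)"
proof -
  let ?m = "\<lambda>(a::'a \<Rightarrow> nat) (x::real ^ 'a). \<Prod>i\<in>UNIV. (x $ i) ^ a i"
  obtain c c' where fg: "f = (\<lambda>x. \<Sum>a\<in>{a. (\<Sum>i\<in>UNIV. a i) \<le> d}. c a * ?m a x)"
      "g = (\<lambda>x. \<Sum>a\<in>{a. (\<Sum>i\<in>UNIV. a i) \<le> e}. c' a * ?m a x)"
    using assms unfolding poly_degree_le_def by auto
  have "poly_degree_le (d + e) (\<lambda>x. (c a * ?m a x) * (c' b * ?m b x))"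
    if "(\<Sum>i\<in>UNIV. a i) \<le> d" "(\<Sum>i\<in>UNIV. b i) \<le> e" for a b :: "'a \<Rightarrow> nat"
  proof -
    have "poly_degree_le (d + e) (\<lambda>x. (c a * c' b) * ?m (\<lambda>i. a i + b i) x)"
      using that by (intro poly_degree_le_scale poly_degree_le_monomial) (simp add: sum.distrib)
    then show ?thesis
      by (simp only: power_add prod.distrib mult.assoc mult.left_commute mult.commute)
  qed
  then show ?thesis
    unfolding fg sum_product by (auto intro!: poly_degree_le_sum)
qed

lemma poly_degree_le_inner:
  assumes "d \<ge> 1"
  shows "poly_degree_le d (\<lambda>x :: real ^ 'n. u \<bullet> x)"
  unfolding inner_vec_def inner_real_def
  by (intro poly_degree_le_sum poly_degree_le_scale poly_degree_le_nth assms)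

lemma poly_degree_le_norm_minus: "poly_degree_le 2 (\<lambda>x :: real ^ 'n. (norm x)\<^sup>2 - k)"
proof -
  have "poly_degree_le (1 + 1) (\<lambda>x :: real ^ 'n. (\<Sum>i\<in>UNIV. x $ i * x $ i) + - k)"
    by (intro poly_degree_le_add poly_degree_le_sum poly_degree_le_const
        poly_degree_le_mult poly_degree_le_nth) auto
  then show ?thesis
    by (simp only: power2_norm_eq_inner inner_vec_def inner_real_def one_add_one
        diff_conv_add_uminus)
qed

lemma poly_degree_le_continuous:
  assumes "poly_degree_le d f"
  shows "continuous_on A f"
proof -
  obtain c where "f = (\<lambda>x. \<Sum>a\<in>{a. (\<Sum>i\<in>UNIV. a i) \<le> d}. c a * (\<Prod>i\<in>UNIV. (x $ i) ^ a i))"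
    using assms unfolding poly_degree_le_def by auto
  then show ?thesis
    by (simp only:) (intro continuous_intros)
qed

section \<open>Antipodal symmetry and positivity of the surface measure\<close>

lemma lborel_distr_uminus_euclidean:
  "distr lborel borel uminus = (lborel :: 'a::euclidean_space measure)"
  by (subst lborel_affine[of "-1" 0]) (auto simp: density_1 one_ennreal_def[symmetric])

lemma sets_surface_measure [measurable_cong]: "sets (surface_measure r) = sets borel"
  by (simp add: surface_measure_def)

text \<open>Here the cone is kept as a preimage under the radial projection, so that the formula
  covers all Borel sets. The projection sends 0 to 0, since \<open>r / 0 = 0\<close>.\<close>

lemma emeasure_surface_measure':
  fixes A :: "(real ^ 'n) set"
  assumes r: "r > 0" and A: "A \<in> sets borel"
  shows "emeasure (surface_measure r) A =
      ennreal (real CARD('n) / r) * emeasure lborel ((\<lambda>x. (r / norm x) *\<^sub>R x) -` A \<inter> cball 0 r)"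
proof -
  have m: "(\<lambda>x::real ^ 'n. (r / norm x) *\<^sub>R x) \<in> restrict_space lborel (cball 0 r) \<rightarrow>\<^sub>M borel"
    by (rule measurable_restrict_space1) measurable
  show ?thesis
    using r A m by (simp add: surface_measure_def emeasure_distr space_restrict_space
        emeasure_restrict_space)
qed

lemma space_surface_measure: "space (surface_measure r) = UNIV"
  using sets_eq_imp_space_eq[OF sets_surface_measure] by simp

lemma finite_surface_measure:
  assumes "r > 0"
  shows "finite_measure (surface_measure r :: (real ^ 'n) measure)"
proof
  show "emeasure (surface_measure r :: (real ^ 'n) measure) (space (surface_measure r)) \<noteq> \<infinity>"
    using assms emeasure_lborel_cball_finite[of "0 :: real ^ 'n" r]
    by (simp add: space_surface_measure emeasure_surface_measure' ennreal_mult_eq_top_iff)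
qed

text \<open>The radial projection commutes with \<open>uminus\<close>, and both the ball and
  Lebesgue measure are invariant under it.\<close>

lemma distr_surface_measure_uminus:
  assumes r: "r > 0"
  shows "distr (surface_measure r) borel uminus = (surface_measure r :: (real ^ 'n) measure)"
proof (rule measure_eqI)
  fix A :: "(real ^ 'n) set"
  assume "A \<in> sets (distr (surface_measure r) borel uminus)"
  then have A: "A \<in> sets borel" by simp
  let ?g = "\<lambda>x::real ^ 'n. (r / norm x) *\<^sub>R x"
  have um: "uminus -` A \<in> sets borel"
    using A measurable_sets[of "uminus :: real ^ 'n \<Rightarrow> _" borel borel A] by simp
  have gm: "?g -` A \<inter> cball 0 r \<in> sets borel"
    using measurable_sets[of ?g borel borel A] A by auto
  have "emeasure (distr (surface_measure r) borel uminus) A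
      = emeasure (surface_measure r) (uminus -` A)"
    using A by (subst emeasure_distr) (auto simp: space_surface_measure)
  also have "\<dots> = ennreal (real CARD('n) / r)
      * emeasure lborel (?g -` (uminus -` A) \<inter> cball 0 r)"
    by (rule emeasure_surface_measure'[OF r um])
  also have "?g -` (uminus -` A) \<inter> cball 0 r = uminus -` (?g -` A \<inter> cball 0 r)"
    by auto
  also have "emeasure lborel (uminus -` (?g -` A \<inter> cball 0 r))
      = emeasure (distr lborel borel uminus) (?g -` A \<inter> cball 0 r)"
    using gm by (subst emeasure_distr) auto
  also have "\<dots> = emeasure lborel (?g -` A \<inter> cball 0 r)"
    by (simp add: lborel_distr_uminus_euclidean)
  also have "ennreal (real CARD('n) / r) * \<dots> = emeasure (surface_measure r) A"
    by (rule emeasure_surface_measure'[OF r A, symmetric])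
  finally show "emeasure (distr (surface_measure r) borel uminus) A = emeasure (surface_measure r) A" .
qed (simp add: sets_surface_measure)

text \<open>The antipodal symmetry turns the integral into its own negative.\<close>

lemma set_integral_surface_odd:
  fixes f :: "real ^ 'n \<Rightarrow> real"
  assumes r: "r > 0" and f: "f \<in> borel_measurable borel" and odd: "\<And>x. f (- x) = - f x"
  shows "(LINT x:sphere 0 r|surface_measure r. f x) = 0"
proof -
  let ?h = "\<lambda>x. indicator (sphere 0 r) x * f x"
  have h: "?h \<in> borel_measurable borel"
    using f by (intro borel_measurable_times borel_measurable_indicator) auto
  have ind: "indicator (sphere 0 r) (- x) = (indicator (sphere 0 r) x :: real)" for x :: "real ^ 'n"
    by (auto simp: indicator_def)
  have "integral\<^sup>L (surface_measure r) ?h = integral\<^sup>L (distr (surface_measure r) borel uminus) ?h"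
    by (simp add: distr_surface_measure_uminus r)
  also have "\<dots> = (\<integral>x. - ?h x \<partial>surface_measure r)"
    using h by (subst integral_distr) (auto simp: odd ind)
  also have "\<dots> = - integral\<^sup>L (surface_measure r) ?h"
    by simp
  finally show ?thesis
    by (simp add: set_lebesgue_integral_def)
qed

lemma set_integrable_surface:
  fixes f :: "real ^ 'n \<Rightarrow> real"
  assumes r: "r > 0" and f: "continuous_on UNIV f"
  shows "set_integrable (surface_measure r) (sphere 0 r) f"
proof -
  interpret finite_measure "surface_measure r :: (real ^ 'n) measure"
    by (rule finite_surface_measure[OF r])
  have "bounded (f ` sphere 0 r)"
    by (intro compact_imp_bounded compact_continuous_image continuous_on_subset[OF f]) auto
  then obtain B where B: "\<forall>x\<in>sphere 0 r. \<bar>f x\<bar> \<le> B" "B > 0"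
    unfolding bounded_pos by auto
  have "f \<in> borel_measurable borel"
    using f by (rule borel_measurable_continuous_onI)
  then show ?thesis
    unfolding set_integrable_def
    by (intro integrable_const_bound[where B = B] AE_I2)
      (use B in \<open>auto simp: indicator_def\<close>)
qed

text \<open>The function vanishes almost everywhere on the sphere. If it were nonzero at
  \<open>x\<close>, continuity would give a nonempty open cone in the ball over points with nonzero
  value; this cone would be Lebesgue null, which is impossible.\<close>

lemma surface_integral_nonneg_eq_0D:
  fixes f :: "real ^ 'n \<Rightarrow> real"
  assumes r: "r > 0" and f: "continuous_on UNIV f"
    and nn: "\<And>x. x \<in> sphere 0 r \<Longrightarrow> f x \<ge> 0"
    and int: "(LINT x:sphere 0 r|surface_measure r. f x) = 0"
    and x: "x \<in> sphere 0 r"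
  shows "f x = 0"
proof (rule ccontr)
  assume nz: "f x \<noteq> 0"
  let ?h = "\<lambda>x. indicator (sphere 0 r) x *\<^sub>R f x"
  let ?g = "\<lambda>x::real ^ 'n. (r / norm x) *\<^sub>R x"
  have fm: "f \<in> borel_measurable borel"
    using f by (rule borel_measurable_continuous_onI)
  have sm: "{y. ?h y \<noteq> 0} \<in> sets borel"
  proof -
    have "{y. ?h y \<noteq> 0} = sphere 0 r \<inter> f -` (- {0})"
      by (auto simp: indicator_def)
    moreover have "f -` (- {0}) \<in> sets borel"
      using measurable_sets[OF fm, of "- {0}"] by simp
    ultimately show ?thesis
      by (auto intro: borel_closed)
  qed
  have "AE x in surface_measure r. ?h x = 0"
    using int set_integrable_surface[OF r f] nn
    unfolding set_lebesgue_integral_def set_integrable_def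
    by (subst (asm) integral_nonneg_eq_0_iff_AE) (auto simp: indicator_def)
  then have null: "emeasure (surface_measure r) {y. ?h y \<noteq> 0} = 0"
    using sm by (subst (asm) AE_iff_measurable[OF _ refl]) (simp_all add: space_surface_measure sets_surface_measure)
  \<comment> \<open>The origin, where the projection is discontinuous, and the boundary sphere are
    left out to make the cone open.\<close>
  let ?U = "{y. y \<in> ball 0 r - {0} \<and> f (?g y) \<in> - {0}}"
  have op: "open ?U"
  proof -
    have "continuous_on (ball 0 r - {0}) (f \<circ> ?g)"
      by (intro continuous_on_compose continuous_on_subset[OF f] continuous_intros) auto
    then have "open ((f \<circ> ?g) -` (- {0}) \<inter> (ball 0 r - {0}))"
      using continuous_on_open_vimage[of "ball 0 r - {0}" "f \<circ> ?g"] by (auto simp: open_Diff)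
    moreover have "(f \<circ> ?g) -` (- {0}) \<inter> (ball 0 r - {0}) = ?U" by auto
    ultimately show ?thesis by simp
  qed
  have "?U \<subseteq> ?g -` {y. ?h y \<noteq> 0} \<inter> cball 0 r"
    using r by (auto simp: indicator_def)
  moreover have "?g -` {y. ?h y \<noteq> 0} \<inter> cball 0 r \<in> sets borel"
  proof -
    have "?g \<in> borel_measurable borel"
      by measurable
    from measurable_sets[OF this sm] show ?thesis
      by (intro sets.Int) (simp_all only: space_borel Int_UNIV_right borel_closed closed_cball)
  qed
  ultimately have "emeasure lborel ?U \<le> emeasure lborel (?g -` {y. ?h y \<noteq> 0} \<inter> cball 0 r)"
    by (intro emeasure_mono) auto
  also have "\<dots> = 0"
  proof -
    have "ennreal (real CARD('n) / r) \<noteq> 0"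
      using r by simp
    then show ?thesis
      using null unfolding emeasure_surface_measure'[OF r sm] by (simp only: mult_eq_0_iff simp_thms)
  qed
  finally have "?U \<in> null_sets lborel"
    using op by (simp add: null_sets_def)
  then have "negligible ?U"
    by (simp add: negligible_iff_null_sets null_sets_completionI)
  then have "?U = {}"
    using op open_not_negligible by blast
  moreover have "(1/2) *\<^sub>R x \<in> ?U"
  proof -
    have "x \<noteq> 0" "?g ((1/2) *\<^sub>R x) = x"
      using x r by auto
    then show ?thesis
      using x r nz by auto
  qed
  ultimately show False by blast
qed

text \<open>The constant 1 is nonzero on the nonempty sphere, so its integral cannot vanish.\<close>

lemma measure_surface_sphere_pos:
  assumes r: "r > 0"
  shows "measure (surface_measure r) (sphere (0 :: real ^ 'n) r) > 0"
proof -
  obtain x :: "real ^ 'n" where "x \<in> sphere 0 r"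
    using vector_choose_size[of r] r by auto
  then have "(LINT x:sphere (0 :: real ^ 'n) r|surface_measure r. 1 :: real) \<noteq> 0"
    using surface_integral_nonneg_eq_0D[OF r, of "\<lambda>_. 1"] by auto
  then show ?thesis
    by (auto simp: set_lebesgue_integral_def zero_less_measure_iff)
qed

section \<open>The dimension of the space of quadratic polynomials\<close>

lemma sum_fun_apply: "(\<Sum>i\<in>I. f i) x = (\<Sum>i\<in>I. f i x)"
  for f :: "'i \<Rightarrow> 'a \<Rightarrow> real"
  by (induction I rule: infinite_finite_induct) auto

text \<open>Independence as an indexed family also forces distinct members: if
  \<open>f i = f j\<close>, the coefficients 1 at \<open>i\<close> and -1 at \<open>j\<close> give a
  vanishing combination.\<close>

lemma independent_family:
  fixes f :: "'i \<Rightarrow> 'a \<Rightarrow> real"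
  assumes fin: "finite I"
    and indep: "\<And>c i. (\<And>x. (\<Sum>i\<in>I. c i * f i x) = 0) \<Longrightarrow> i \<in> I \<Longrightarrow> c i = 0"
  shows "fun_vs.independent (f ` I)" and "card (f ` I) = card I"
proof -
  have inj: "inj_on f I"
  proof (rule inj_onI, rule ccontr)
    fix i j assume ij: "i \<in> I" "j \<in> I" "f i = f j" "i \<noteq> j"
    let ?c = "\<lambda>k. (if k = i then 1 else 0) - (if k = j then 1 else 0 :: real)"
    have "(\<Sum>k\<in>I. ?c k * f k x) = 0" for x
      using ij fin by (simp add: left_diff_distrib sum_subtractf sum.delta if_distrib[of "\<lambda>z. z * _"] cong: if_cong)
    from indep[of ?c, OF this ij(1)] ij(4) show False by simp
  qed
  then show "card (f ` I) = card I"
    by (rule card_image)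
  show "fun_vs.independent (f ` I)"
    unfolding fun_vs.dependent_finite[OF finite_imageI[OF fin]]
  proof clarify
    fix u i
    assume i: "i \<in> I" "u (f i) \<noteq> 0" and z: "(\<Sum>v\<in>f ` I. (\<lambda>x. u v * v x)) = 0"
    have "(\<Sum>i\<in>I. u (f i) * f i x) = 0" for x
      using fun_cong[OF z, of x] by (simp add: sum_fun_apply sum.reindex[OF inj])
    from indep[of "\<lambda>i. u (f i)", OF this i(1)] i(2) show False by simp
  qed
qed

text \<open>The point indicators of \<open>Z\<close> are independent, so they cannot outnumber a
  finite spanning set.\<close>

lemma card_le_of_deltas_in_span:
  fixes Z :: "'a set" and H :: "('a \<Rightarrow> real) set"
  assumes "finite Z" "finite H"
    and "\<And>z. z \<in> Z \<Longrightarrow> (\<lambda>y. if y = z then 1 else 0) \<in> fun_vs.span H"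
  shows "card Z \<le> card H"
proof -
  let ?\<delta> = "\<lambda>z y. if y = z then 1 else 0 :: real"
  have indep: "c i = 0" if "\<And>x. (\<Sum>i\<in>Z. c i * ?\<delta> i x) = 0" "i \<in> Z" for c i
    using that(1)[of i] that(2) \<open>finite Z\<close> by (simp add: if_distrib[of "\<lambda>z. _ * z"] cong: if_cong)
  have *: "fun_vs.independent (?\<delta> ` Z)" "card (?\<delta> ` Z) = card Z"
    by (rule independent_family[OF \<open>finite Z\<close>]; rule indep; assumption)+
  then show ?thesis
    using fun_vs.independent_span_bound[OF \<open>finite H\<close> *(1)] assms(3) by auto
qed

text \<open>Restriction to \<open>X\<close> is linear, injective on \<open>V\<close>, and lands in
  the span of the point indicators of \<open>X\<close>.\<close>

lemma dim_bounds_of_determining_set: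
  fixes V I :: "('a \<Rightarrow> real) set"
  assumes V: "fun_vs.subspace V" and X: "finite X"
    and det: "\<And>f. f \<in> V \<Longrightarrow> (\<And>x. x \<in> X \<Longrightarrow> f x = 0) \<Longrightarrow> f = 0"
    and I: "I \<subseteq> V" "fun_vs.independent I"
  shows "fun_vs.dim V \<le> card X" and "card I \<le> fun_vs.dim V"
proof -
  let ?R = "\<lambda>(f :: 'a \<Rightarrow> real) x. if x \<in> X then f x else 0"
  let ?\<delta> = "\<lambda>z y. if y = z then 1 else 0 :: real"
  interpret R: Vector_Spaces.linear "\<lambda>c (f :: 'a \<Rightarrow> real) x. c * f x" "\<lambda>c (f :: 'a \<Rightarrow> real) x. c * f x" ?R
    by unfold_locales (auto simp: fun_eq_iff algebra_simps)
  obtain B where B: "B \<subseteq> V" "fun_vs.independent B" "V \<subseteq> fun_vs.span B" "card B = fun_vs.dim V"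
    by (rule fun_vs.basis_exists)
  have BV: "fun_vs.span B = V"
    using B V fun_vs.span_minimal by blast
  have inj: "inj_on ?R (fun_vs.span B)"
    unfolding BV R.inj_on_iff_eq_0[OF V]
  proof (intro ballI impI)
    fix f assume "f \<in> V" "?R f = 0"
    then show "f = 0"
      by (intro det) (auto simp: fun_eq_iff split: if_splits)
  qed
  have "?R f \<in> fun_vs.span (?\<delta> ` X)" for f
  proof -
    have "?R f = (\<Sum>z\<in>X. (\<lambda>y. f z * ?\<delta> z y))"
      using X by (auto simp: fun_eq_iff sum_fun_apply if_distrib[of "\<lambda>z. _ * z"] cong: if_cong)
    also have "\<dots> \<in> fun_vs.span (?\<delta> ` X)"
      by (intro fun_vs.span_sum fun_vs.span_scale fun_vs.span_base) auto
    finally show ?thesis .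
  qed
  then have "finite (?R ` B) \<and> card (?R ` B) \<le> card (?\<delta> ` X)"
    using R.independent_injective_image[OF B(2) inj] X
    by (intro fun_vs.independent_span_bound) auto
  moreover have "inj_on ?R B"
    using inj fun_vs.span_superset by (rule inj_on_subset)
  ultimately have B': "finite B" "card B \<le> card X"
    using card_image_le[OF X, of ?\<delta>] by (auto simp: card_image finite_image_iff)
  then show "fun_vs.dim V \<le> card X"
    using B by simp
  show "card I \<le> fun_vs.dim V"
    using fun_vs.independent_span_bound[OF B'(1) I(2)] I(1) B by auto
qed

section \<open>Quadratic polynomials on two concentric spheres\<close>

lemma subspace_poly_space_on: "fun_vs.subspace (poly_space_on d S)"
  unfolding fun_vs.subspace_def
proof (intro conjI ballI allI)
  show "0 \<in> poly_space_on d S"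
    unfolding poly_space_on_def using poly_degree_le_const[of d 0]
    by (auto simp: fun_eq_iff intro!: exI[of _ "\<lambda>_. 0"])
next
  fix f g :: "real ^ 'a \<Rightarrow> real" assume "f \<in> poly_space_on d S" "g \<in> poly_space_on d S"
  then obtain f' g' where "poly_degree_le d f'" "f = (\<lambda>x. if x \<in> S then f' x else 0)"
    "poly_degree_le d g'" "g = (\<lambda>x. if x \<in> S then g' x else 0)"
    unfolding poly_space_on_def by auto
  then show "f + g \<in> poly_space_on d S"
    unfolding poly_space_on_def
    by (auto simp: fun_eq_iff intro!: exI[of _ "\<lambda>x. f' x + g' x"] poly_degree_le_add)
next
  fix f :: "real ^ 'a \<Rightarrow> real" and c assume "f \<in> poly_space_on d S"
  then obtain f' where "poly_degree_le d f'" "f = (\<lambda>x. if x \<in> S then f' x else 0)"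
    unfolding poly_space_on_def by auto
  then show "(\<lambda>x. c * f x) \<in> poly_space_on d S"
    unfolding poly_space_on_def
    by (auto simp: fun_eq_iff intro!: exI[of _ "\<lambda>x. c * f' x"] poly_degree_le_scale)
qed

text \<open>Homogenization: with \<open>homog x None = 1\<close>, the polynomials of degree at most 2 are the quadratic
  forms in \<open>homog x\<close>, and the squares of sums of one or two coordinates form a basis of these.\<close>

definition homog :: "real ^ 'n \<Rightarrow> 'n option \<Rightarrow> real" where
  "homog x p = (case p of None \<Rightarrow> 1 | Some i \<Rightarrow> x $ i)"

lemma quadratic_form_homog:
  fixes M :: "'n::finite option \<Rightarrow> 'n option \<Rightarrow> real"
  assumes sym: "\<And>p q. M p q = M q p"
  shows "(\<Sum>p\<in>UNIV. \<Sum>q\<in>UNIV. M p q * homog x p * homog x q)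
    = M None None + 2 * (\<Sum>i\<in>UNIV. M None (Some i) * x $ i)
      + (\<Sum>i\<in>UNIV. \<Sum>j\<in>UNIV. M (Some i) (Some j) * x $ i * x $ j)"
  by (simp add: UNIV_option_conv sum.reindex homog_def sum.distrib sym[of "Some _" None])

text \<open>Evaluation at a few points suffices. Opposite points on an axis isolate the linear
  coefficients, the two radii separate the constant from the diagonal coefficients, and points on
  the bisector of two axes give the mixed ones.\<close>

lemma quadratic_form_eq_0_of_spheres:
  fixes M :: "'n::finite option \<Rightarrow> 'n option \<Rightarrow> real"
  assumes sym: "\<And>p q. M p q = M q p"
    and r: "0 < r1" "0 < r2" "r1 \<noteq> r2"
    and zero: "\<And>x. x \<in> sphere 0 r1 \<union> sphere 0 r2 \<Longrightarrow>
      (\<Sum>p\<in>UNIV. \<Sum>q\<in>UNIV. M p q * homog x p * homog x q) = 0"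
  shows "M p q = 0"
proof -
  note Q = zero[unfolded quadratic_form_homog[of M, OF sym]]
  have ax: "M None None + 2 * (M None (Some i) * t) + M (Some i) (Some i) * t * t = 0"
    if "\<bar>t\<bar> = r1 \<or> \<bar>t\<bar> = r2" for i t
  proof -
    have "axis i t \<in> sphere 0 r1 \<union> sphere 0 r2"
      using that by (auto simp: norm_eq_sqrt_inner inner_axis_axis)
    from Q[OF this] show ?thesis
      by (simp add: axis_def if_distrib[of "\<lambda>z. _ * z"] if_distrib[of "\<lambda>z. z * _"] cong: if_cong)
  qed
  have b: "M None (Some i) = 0" for i
  proof -
    have "M None None + 2 * (M None (Some i) * r1) + M (Some i) (Some i) * r1 * r1 = 0"
      "M None None - 2 * (M None (Some i) * r1) + M (Some i) (Some i) * r1 * r1 = 0"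
      using ax[of r1 i] ax[of "- r1" i] r by simp_all
    then have "M None (Some i) * r1 = 0"
      by linarith
    then show ?thesis using r by simp
  qed
  have a: "M None None = 0 \<and> M (Some i) (Some i) = 0" for i
  proof -
    have "M None None + M (Some i) (Some i) * r1\<^sup>2 = 0" "M None None + M (Some i) (Some i) * r2\<^sup>2 = 0"
      using ax[of r1 i] ax[of r2 i] r by (auto simp: b power2_eq_square)
    moreover from this have "M (Some i) (Some i) * (r1\<^sup>2 - r2\<^sup>2) = 0"
      unfolding right_diff_distrib by linarith
    moreover have "r1\<^sup>2 \<noteq> r2\<^sup>2"
      using r by (simp add: power2_eq_iff)
    ultimately show ?thesis by auto
  qed
  have o: "M (Some i) (Some j) = 0" if "i \<noteq> j" for i j
  proof -
    \<comment> \<open>Chosen so that \<open>2 * t^2 = r1^2\<close>, which puts the test point on the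
      first sphere.\<close>
    define t where "t = r1 / sqrt 2"
    have t: "t > 0" using r by (simp add: t_def)
    let ?x = "axis i t + axis j t :: real ^ 'n"
    have "norm ?x = r1"
    proof -
      have "(norm ?x)\<^sup>2 = 2 * t\<^sup>2"
        unfolding power2_norm_eq_inner using that
        by (simp add: inner_add_left inner_add_right inner_axis_axis power2_eq_square)
      also have "\<dots> = r1\<^sup>2" by (simp add: t_def power_divide)
      finally show ?thesis using r by (simp add: power2_eq_iff_nonneg)
    qed
    then have "?x \<in> sphere 0 r1 \<union> sphere 0 r2" by simp
    from Q[OF this]
    have "(\<Sum>k\<in>UNIV. \<Sum>l\<in>UNIV. M (Some k) (Some l) * ?x $ k * ?x $ l) = 0"
      by (simp only: a b) simp
    moreover have "(\<Sum>k\<in>UNIV. \<Sum>l\<in>UNIV. M (Some k) (Some l) * ?x $ k * ?x $ l)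
        = 2 * M (Some i) (Some j) * t\<^sup>2"
      by (simp add: axis_def distrib_left distrib_right sum.distrib if_distrib[of "\<lambda>z. _ * z"]
          if_distrib[of "\<lambda>z. z * _"] a sym[of "Some j" "Some i"] power2_eq_square cong: if_cong)
    ultimately show ?thesis using t by simp
  qed
  show ?thesis
    using a b o by (cases p; cases q) (auto simp: sym[of "Some _" None], metis)
qed

text \<open>Pascal's rule for the \<open>CARD('n) + 1\<close> homogeneous coordinates.\<close>

lemma card_subsets_1_2:
  "card {T :: 'n::finite option set. card T = 1 \<or> card T = 2} = (CARD('n) + 2) choose 2"
proof -
  have "{T :: 'n option set. card T = 1 \<or> card T = 2}
      = {T. T \<subseteq> UNIV \<and> card T = 1} \<union> {T. T \<subseteq> UNIV \<and> card T = 2}" by auto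
  also have "card \<dots> = (CARD('n option) choose 1) + (CARD('n option) choose 2)"
    by (subst card_Un_disjoint) (auto simp: n_subsets[OF finite] simp del: subset_UNIV top_greatest)
  also have "\<dots> = (CARD('n) + 2) choose 2"
    by (simp add: numeral_2_eq_2)
  finally show ?thesis .
qed

text \<open>A vanishing combination of the squares is a quadratic form in \<open>homog x\<close>
  that is zero on both spheres, so its symmetric matrix is zero and the coefficients can be read off
  from the entries.\<close>

lemma poly_space_on_independent:
  fixes r1 r2 :: real
  assumes r: "0 < r1" "0 < r2" "r1 \<noteq> r2"
  obtains I where "I \<subseteq> poly_space_on 2 (sphere 0 r1 \<union> sphere 0 r2 :: (real ^ 'n) set)"
    "fun_vs.independent I" "card I = (CARD('n) + 2) choose 2"
proof -
  let ?S = "sphere 0 r1 \<union> sphere 0 r2 :: (real ^ 'n) set"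
  let ?J = "{T :: 'n option set. card T = 1 \<or> card T = 2}"
  let ?g = "\<lambda>T x. if x \<in> ?S then (\<Sum>p\<in>T. homog x p) * (\<Sum>p\<in>T. homog x p) else 0"
  have indep: "c T = 0" if z: "\<And>x. (\<Sum>T\<in>?J. c T * ?g T x) = 0" and T: "T \<in> ?J" for c T
  proof -
    \<comment> \<open>The symmetric matrix of the combination of squares with coefficients
      \<open>c\<close>.\<close>
    define M where "M p q = (\<Sum>T\<in>?J. c T * (if p \<in> T \<and> q \<in> T then 1 else 0))" for p q
    have M: "M p q = 0" for p q
    proof (rule quadratic_form_eq_0_of_spheres[of M, OF _ r])
      show "M p q = M q p" for p q by (simp add: M_def conj_commute)
      fix x :: "real ^ 'n" assume x: "x \<in> ?S"
      have sq: "(\<Sum>p\<in>T. homog x p) * (\<Sum>p\<in>T. homog x p)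
          = (\<Sum>p\<in>UNIV. \<Sum>q\<in>UNIV. (if p \<in> T \<and> q \<in> T then 1 else 0) * homog x p * homog x q)" for T
      proof -
        have "(\<Sum>p\<in>T. homog x p) = (\<Sum>p\<in>UNIV. if p \<in> T then homog x p else 0)"
          by (simp add: sum.If_cases)
        then show ?thesis
          by (simp only: sum_product) (auto intro!: sum.cong)
      qed
      have "(\<Sum>p\<in>UNIV. \<Sum>q\<in>UNIV. M p q * homog x p * homog x q) =
        (\<Sum>p\<in>UNIV. \<Sum>q\<in>UNIV. \<Sum>T\<in>?J. c T * ((if p \<in> T \<and> q \<in> T then 1 else 0) * homog x p * homog x q))"
        unfolding M_def by (simp only: sum_distrib_right mult.assoc)
      also have "\<dots> = (\<Sum>p\<in>UNIV. \<Sum>T\<in>?J. \<Sum>q\<in>UNIV. c T * ((if p \<in> T \<and> q \<in> T then 1 else 0) * homog x p * homog x q))"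
        by (intro sum.cong refl sum.swap)
      also have "\<dots> = (\<Sum>T\<in>?J. \<Sum>p\<in>UNIV. \<Sum>q\<in>UNIV. c T * ((if p \<in> T \<and> q \<in> T then 1 else 0) * homog x p * homog x q))"
        by (rule sum.swap)
      also have "\<dots> = (\<Sum>T\<in>?J. c T * ((\<Sum>p\<in>T. homog x p) * (\<Sum>p\<in>T. homog x p)))"
        by (simp only: sq sum_distrib_left[of "c _"])
      also have "\<dots> = 0"
        using z[of x] x by simp
      finally show "(\<Sum>p\<in>UNIV. \<Sum>q\<in>UNIV. M p q * homog x p * homog x q) = 0" .
    qed
    \<comment> \<open>An off-diagonal entry receives a contribution only from the set
      \<open>{p, q}\<close>.\<close>
    have pair: "c {p, q} = 0" if "p \<noteq> q" for p q
    proof -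
      have "M p q = (\<Sum>T\<in>?J. if T = {p, q} then c T else 0)"
        unfolding M_def
      proof (intro sum.cong refl)
        fix T assume T: "T \<in> ?J"
        have "p \<in> T \<and> q \<in> T \<longleftrightarrow> T = {p, q}"
        proof
          assume "p \<in> T \<and> q \<in> T"
          then have "{p, q} \<subseteq> T" by auto
          moreover have "card T \<le> card {p, q}" using T that by auto
          ultimately show "T = {p, q}"
            using card_seteq[of T "{p, q}"] by simp
        qed auto
        then show "c T * (if p \<in> T \<and> q \<in> T then 1 else 0) = (if T = {p, q} then c T else 0)"
          by auto
      qed
      also have "\<dots> = c {p, q}" using that by simp
      finally show ?thesis using M by simp
    qed
    \<comment> \<open>A diagonal entry also collects the pairs through \<open>p\<close>, but their
      coefficients are already known to vanish.\<close>
    have single: "c {p} = 0" for p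
    proof -
      have "M p p = (\<Sum>T\<in>?J. if T = {p} then c T else 0)"
        unfolding M_def
      proof (intro sum.cong refl)
        fix T assume T: "T \<in> ?J"
        then consider q where "T = {q}" | q s where "T = {q, s}" "q \<noteq> s"
          by (auto simp: card_1_singleton_iff card_2_iff)
        then show "c T * (if p \<in> T \<and> p \<in> T then 1 else 0) = (if T = {p} then c T else 0)"
          by cases (auto simp: pair)
      qed
      then show ?thesis using M by simp
    qed
    show ?thesis
      using T pair single by (auto simp: card_1_singleton_iff card_2_iff)
  qed
  have *: "fun_vs.independent (?g ` ?J)" "card (?g ` ?J) = card ?J"
    by (rule independent_family[OF finite]; rule indep; assumption)+
  have "?g T \<in> poly_space_on 2 ?S" for T
  proof -
    have h: "poly_degree_le 1 (\<lambda>x. homog x p)" for p :: "'n option"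
      by (cases p) (auto simp: homog_def intro: poly_degree_le_const poly_degree_le_nth)
    have "poly_degree_le (1 + 1) (\<lambda>x. (\<Sum>p\<in>T. homog x p) * (\<Sum>p\<in>T. homog x p))"
      by (intro poly_degree_le_mult poly_degree_le_sum h)
    then show ?thesis
      unfolding poly_space_on_def one_add_one by (intro CollectI exI conjI) (rule refl)
  qed
  then show thesis
    using that[of "?g ` ?J"] * card_subsets_1_2 by auto
qed

section \<open>Two-distance sets\<close>

text \<open>Padding with repeated or arbitrary values lets sets of fewer than two angles be treated
  as pairs.\<close>

lemma card_le_2_avoidingE:
  fixes A :: "real set"
  assumes "finite A" "card A \<le> 2" "z \<notin> A"
  obtains a b where "A \<subseteq> {a, b}" "z \<noteq> a" "z \<noteq> b"
proof -
  consider "card A = 0" | "card A = 1" | "card A = 2" using assms(2) by linarith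
  then show thesis
  proof cases
    case 1
    then show thesis using assms(1) that[of "z + 1" "z + 1"] by auto
  next
    case 2
    then obtain a where "A = {a}" by (auto simp: card_1_singleton_iff)
    then show thesis using assms(3) that[of a a] by auto
  next
    case 3
    then obtain a b where "A = {a, b}" by (auto simp: card_2_iff)
    then show thesis using assms(3) that[of a b] by auto
  qed
qed

text \<open>The span of \<open>card A choose 2\<close> products of linear forms is shown to contain,
  in turn, the constants, the linear forms, the quadratic forms, and finally the indicator of every
  point of \<open>Z\<close>.\<close>

lemma card_two_distance_bound:
  fixes A Z :: "'v::real_inner set"
  assumes finA: "finite A" and finZ: "finite Z" and card: "card A \<ge> 3"
    and sum: "(\<Sum>x\<in>A. x) = 0" and span: "span A = UNIV"
    and mixed: "\<And>x y. x \<in> A \<Longrightarrow> y \<in> Z \<Longrightarrow> x \<bullet> y \<in> {g, h}"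
    and Z: "\<And>y z. y \<in> Z \<Longrightarrow> z \<in> Z \<Longrightarrow> y \<noteq> z \<Longrightarrow> y \<bullet> z \<in> {a, b}"
    and norm: "\<And>z. z \<in> Z \<Longrightarrow> z \<bullet> z \<noteq> a \<and> z \<bullet> z \<noteq> b"
  shows "card Z \<le> card A choose 2"
proof -
  define v where "v = real (card A)"
  \<comment> \<open>With these, \<open>t^2 = p * t + q\<close> has the roots \<open>g\<close> and
    \<open>h\<close>.\<close>
  define p where "p = g + h"
  define q where "q = - g * h"
  \<comment> \<open>Large enough that the two coefficients in \<open>gen1\<close> and
    \<open>gen2\<close>, by which the argument later divides, are nonzero.\<close>
  define c where "c = \<bar>p\<bar> + \<bar>q\<bar> + 1"
  have v: "v \<ge> 3" using card by (simp add: v_def)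
  have c1: "c \<ge> 1" by (simp add: c_def)
  have gen1: "- v * c - (p - 2 * c) \<noteq> 0"
  proof -
    have "1 * c \<le> (v - 2) * c"
      using v c1 by (intro mult_right_mono) auto
    then show ?thesis by (simp add: c_def algebra_simps abs_if split: if_splits)
  qed
  have gen2: "(v - 1) * c\<^sup>2 - q \<noteq> 0"
  proof -
    have "c \<le> c\<^sup>2" using c1 by (simp add: self_le_power)
    moreover have "1 * c\<^sup>2 \<le> (v - 1) * c\<^sup>2"
      using v by (intro mult_right_mono) auto
    ultimately have "c \<le> (v - 1) * c\<^sup>2" by linarith
    then show ?thesis unfolding c_def[symmetric] using c_def by linarith
  qed
  let ?m = "\<lambda>x y. x \<bullet> y - c"
  let ?P = "\<lambda>f y. if y \<in> Z then f y else 0 :: real"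
  let ?J = "{T. T \<subseteq> A \<and> card T = 2}"
  define H where "H = (\<lambda>T. ?P (\<lambda>y. \<Prod>x\<in>T. ?m x y)) ` ?J"
  \<comment> \<open>Functions are cut off outside \<open>Z\<close>, so that only their values on
    \<open>Z\<close> matter.\<close>
  define good where "good f \<longleftrightarrow> ?P f \<in> fun_vs.span H" for f
  have good_cong: "good f" if "good f'" "\<And>y. y \<in> Z \<Longrightarrow> f y = f' y" for f f'
  proof -
    have "?P f = ?P f'" using that(2) by auto
    then show ?thesis using that(1) by (simp add: good_def)
  qed
  have good_add: "good (\<lambda>y. f y + f' y)" if "good f" "good f'" for f f'
  proof -
    have "?P (\<lambda>y. f y + f' y) = ?P f + ?P f'" by (auto simp: fun_eq_iff)
    moreover have "?P f + ?P f' \<in> fun_vs.span H"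
      using that unfolding good_def by (rule fun_vs.span_add)
    ultimately show ?thesis unfolding good_def by (simp only:)
  qed
  have good_scale: "good (\<lambda>y. k * f y)" if "good f" for f k
  proof -
    have "?P (\<lambda>y. k * f y) = (\<lambda>y. k * ?P f y)" by (auto simp: fun_eq_iff)
    moreover have "(\<lambda>y. k * ?P f y) \<in> fun_vs.span H"
      using that unfolding good_def by (rule fun_vs.span_scale)
    ultimately show ?thesis unfolding good_def by (simp only:)
  qed
  have good_0: "good (\<lambda>_. 0)"
    using fun_vs.span_zero[of H] by (simp add: good_def zero_fun_def)
  have good_sum: "good (\<lambda>y. \<Sum>i\<in>I. f i y)" if "\<And>i. i \<in> I \<Longrightarrow> good (f i)" for f and I :: "'v set"
    using that by (induction I rule: infinite_finite_induct) (auto intro: good_0 good_add)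
  have good_pair: "good (\<lambda>y. ?m x y * ?m x' y)" if "x \<in> A" "x' \<in> A" "x \<noteq> x'" for x x'
    unfolding good_def H_def using that
    by (intro fun_vs.span_base image_eqI[of _ _ "{x, x'}"]) (auto simp: fun_eq_iff)
  have sq: "?m x y * ?m x y = (p - 2 * c) * ?m x y + (p * c + q - c\<^sup>2)" if "x \<in> A" "y \<in> Z" for x y
    using mixed[OF that] by (auto simp: p_def q_def power2_eq_square algebra_simps)
  have sum_m: "(\<Sum>x\<in>A. ?m x y) = - v * c" for y
    by (simp add: sum_subtractf inner_sum_left[symmetric] sum v_def)
  \<comment> \<open>The full sum of the factors \<open>?m x' y\<close> is constant; removing the
    diagonal term and reducing its square by \<open>sq\<close> leaves an affine function of
    \<open>?m x y\<close>.\<close>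
  have row: "(\<Sum>x'\<in>A - {x}. ?m x y * ?m x' y) =
      (- v * c - (p - 2 * c)) * ?m x y - (p * c + q - c\<^sup>2)" if "x \<in> A" "y \<in> Z" for x y
  proof -
    have "(\<Sum>x'\<in>A - {x}. ?m x y * ?m x' y) = ?m x y * (\<Sum>x'\<in>A - {x}. ?m x' y)"
      by (simp only: sum_distrib_left)
    also have "(\<Sum>x'\<in>A - {x}. ?m x' y) = - v * c - ?m x y"
      using sum.remove[OF finA that(1), of "\<lambda>x. ?m x y"] sum_m[of y] by linarith
    also have "?m x y * (- v * c - ?m x y) = - v * c * ?m x y - ?m x y * ?m x y"
      by (simp only: right_diff_distrib mult.commute)
    finally show ?thesis
      unfolding sq[OF that] by (simp add: algebra_simps)
  qed
  have good_row: "good (\<lambda>y. \<Sum>x'\<in>A - {x}. ?m x y * ?m x' y)" if "x \<in> A" for x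
    using that by (intro good_sum good_pair) auto
  \<comment> \<open>Summing \<open>row\<close> over all \<open>x\<close> removes the remaining
    linear terms, again by \<open>sum_m\<close>, and leaves a constant that is nonzero by
    \<open>gen2\<close>.\<close>
  have good_1: "good (\<lambda>_. 1)"
  proof -
    have "(\<Sum>x\<in>A. \<Sum>x'\<in>A - {x}. ?m x y * ?m x' y) = v * ((v - 1) * c\<^sup>2 - q)" if "y \<in> Z" for y
    proof -
      have "(\<Sum>x\<in>A. \<Sum>x'\<in>A - {x}. ?m x y * ?m x' y)
          = (\<Sum>x\<in>A. (- v * c - (p - 2 * c)) * ?m x y - (p * c + q - c\<^sup>2))"
        using that by (intro sum.cong refl row)
      also have "\<dots> = (- v * c - (p - 2 * c)) * (- v * c) - v * (p * c + q - c\<^sup>2)"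
        by (simp only: sum_subtractf sum_distrib_left[symmetric] sum_m[unfolded sum_subtractf])
          (simp add: v_def algebra_simps)
      finally show ?thesis by (simp add: power2_eq_square algebra_simps)
    qed
    moreover have "v * ((v - 1) * c\<^sup>2 - q) \<noteq> 0" using gen2 v by simp
    moreover have "good (\<lambda>y. inverse (v * ((v - 1) * c\<^sup>2 - q)) * (\<Sum>x\<in>A. \<Sum>x'\<in>A - {x}. ?m x y * ?m x' y))"
      by (intro good_scale good_sum good_row)
    ultimately show ?thesis
      by (elim good_cong) (simp del: inverse_mult_distrib)
  qed
  have good_const: "good (\<lambda>_. k)" for k
    using good_scale[OF good_1, of k] by simp
  \<comment> \<open>Once constants are available, \<open>row\<close> can be solved for
    \<open>?m x y\<close>, because \<open>gen1\<close> makes its coefficient nonzero.\<close>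
  have good_m: "good (?m x)" if "x \<in> A" for x
  proof -
    let ?k = "- v * c - (p - 2 * c)"
    have "good (\<lambda>y. inverse ?k * ((\<Sum>x'\<in>A - {x}. ?m x y * ?m x' y) + (p * c + q - c\<^sup>2)))"
      by (intro good_scale good_add good_row good_const that)
    then show ?thesis
    proof (rule good_cong)
      fix y assume "y \<in> Z"
      have "inverse ?k * (?k * ?m x y) = ?m x y"
        using gen1 by (simp only: mult.assoc[symmetric] left_inverse mult_1_left not_False_eq_True)
      then show "?m x y = inverse ?k * ((\<Sum>x'\<in>A - {x}. ?m x y * ?m x' y) + (p * c + q - c\<^sup>2))"
        unfolding row[OF that \<open>y \<in> Z\<close>] by (simp only: diff_add_cancel)
    qed
  qed
  have good_inner_A: "good (\<lambda>y. x \<bullet> y)" if "x \<in> A" for x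
    using good_add[OF good_m[OF that] good_const[of c]] by simp
  have good_inner_inner_A: "good (\<lambda>y. (x \<bullet> y) * (x' \<bullet> y))" if "x \<in> A" "x' \<in> A" for x x'
  proof -
    have "good (\<lambda>y. ?m x y * ?m x' y)"
    proof (cases "x = x'")
      case True
      have "good (\<lambda>y. (p - 2 * c) * ?m x y + (p * c + q - c\<^sup>2))"
        using that by (intro good_add good_scale good_m good_const)
      then show ?thesis
        by (rule good_cong) (use sq[OF that(1)] True in simp)
    qed (use that good_pair in blast)
    then have "good (\<lambda>y. ?m x y * ?m x' y + (c * (x \<bullet> y) + (c * (x' \<bullet> y) + - c * c)))"
      using that by (intro good_add good_scale good_inner_A good_const)
    then show ?thesis
      by (rule good_cong) (simp add: algebra_simps)
  qed
  \<comment> \<open>Since \<open>A\<close> spans, linearity extends the result to all vectors, for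
    products one factor at a time.\<close>
  have good_inner: "good (\<lambda>y. u \<bullet> y)" for u
  proof -
    have "u \<in> span A" using span by simp
    then show ?thesis
      by (induction rule: span_induct_alt)
        (auto simp: inner_add_left good_0 intro!: good_add good_scale good_inner_A)
  qed
  have good_inner_inner_A': "good (\<lambda>y. (u \<bullet> y) * (x \<bullet> y))" if "x \<in> A" for u x
  proof -
    have "u \<in> span A" using span by simp
    then show ?thesis
    proof (induction rule: span_induct_alt)
      case (step k x' u)
      have "good (\<lambda>y. k * ((x' \<bullet> y) * (x \<bullet> y)) + (u \<bullet> y) * (x \<bullet> y))"
        by (rule good_add[OF good_scale[OF good_inner_inner_A[OF step(1) that]] step(2)])
      then show ?case by (rule good_cong) (simp add: inner_add_left algebra_simps)
    qed (simp add: good_0)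
  qed
  have good_inner_inner: "good (\<lambda>y. (u \<bullet> y) * (u' \<bullet> y))" for u u'
  proof -
    have "u' \<in> span A" using span by simp
    then show ?thesis
    proof (induction rule: span_induct_alt)
      case (step k x' u')
      have "good (\<lambda>y. k * ((u \<bullet> y) * (x' \<bullet> y)) + (u \<bullet> y) * (u' \<bullet> y))"
        by (rule good_add[OF good_scale[OF good_inner_inner_A'[OF step(1)]] step(2)])
      then show ?case by (rule good_cong) (simp add: inner_add_left algebra_simps)
    qed (simp add: good_0)
  qed
  have delta: "(\<lambda>y. if y = z then 1 else 0) \<in> fun_vs.span H" if z: "z \<in> Z" for z
  proof -
    \<comment> \<open>The polynomial \<open>(t - a) * (t - b)\<close> at
      \<open>t = z \<bullet> y\<close> kills every other point of \<open>Z\<close>; its value at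
      \<open>z\<close> itself is \<open>?k\<close>, nonzero by the norm condition.\<close>
    let ?k = "(z \<bullet> z - a) * (z \<bullet> z - b)"
    have "good (\<lambda>y. inverse ?k * ((z \<bullet> y) * (z \<bullet> y) + (- (a + b) * (z \<bullet> y) + a * b)))"
      by (intro good_scale good_add good_inner_inner good_inner good_const)
    then have "good (\<lambda>y. if y = z then 1 else 0)"
    proof (rule good_cong)
      fix y assume y: "y \<in> Z"
      have "(z \<bullet> y) * (z \<bullet> y) + (- (a + b) * (z \<bullet> y) + a * b) = (z \<bullet> y - a) * (z \<bullet> y - b)"
        by (simp add: algebra_simps)
      also have "\<dots> = (if y = z then ?k else 0)"
        using Z[OF z y] by auto
      finally show "(if y = z then 1 else 0) =
          inverse ?k * ((z \<bullet> y) * (z \<bullet> y) + (- (a + b) * (z \<bullet> y) + a * b))"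
        using norm[OF z] by (simp del: inverse_mult_distrib)
    qed
    moreover have "?P (\<lambda>y. if y = z then 1 else 0) = (\<lambda>y. if y = z then 1 else 0)"
      using z by auto
    ultimately show ?thesis by (simp add: good_def)
  qed
  have finJ: "finite ?J" using finA by simp
  have "card Z \<le> card H"
    using finJ by (intro card_le_of_deltas_in_span finZ delta) (simp add: H_def)
  also have "\<dots> \<le> card ?J"
    unfolding H_def by (rule card_image_le[OF finJ])
  also have "\<dots> = card A choose 2"
    by (rule n_subsets[OF finA])
  finally show ?thesis .
qed

section \<open>Designs on two spheres\<close>

text \<open>The coefficients are layer weight over surface area. They are positive because a
  nonempty layer of radius 0 would contain the origin.\<close>

lemma design_sphere_integral:
  fixes X :: "(real ^ 'n) set" and r :: "nat \<Rightarrow> real"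
  assumes design: "euclidean_design 4 X w Y r" and nz: "0 \<notin> X"
  obtains k1 k2 where "k1 > 0" "k2 > 0"
    "\<And>f. poly_degree_le 4 f \<Longrightarrow>
      k1 * (LINT x:sphere 0 (r 1)|surface_measure (r 1). f x)
      + k2 * (LINT x:sphere 0 (r 2)|surface_measure (r 2). f x) = (\<Sum>u\<in>X. w u * f u)"
proof -
  have r: "r i > 0" if "i \<in> {1, 2}" for i
  proof -
    have "Y i \<noteq> {}" "0 \<le> r i" "Y i \<subseteq> sphere 0 (r i)" "0 \<notin> Y i"
      using design nz that unfolding euclidean_design_def on_two_concentric_spheres_def by auto
    then show ?thesis by (cases "r i = 0") auto
  qed
  let ?k = "\<lambda>i. (\<Sum>u\<in>Y i. w u) / measure (surface_measure (r i)) (sphere (0 :: real ^ 'n) (r i))"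
  have "?k i > 0" if i: "i \<in> {1, 2}" for i
  proof -
    have "Y i \<noteq> {}" "finite (Y i)" "\<And>u. u \<in> Y i \<Longrightarrow> w u > 0"
      using design i
      unfolding euclidean_design_def on_two_concentric_spheres_def weighted_finite_set_def by auto
    then have "(\<Sum>u\<in>Y i. w u) > 0" by (intro sum_pos) auto
    then show ?thesis
      using measure_surface_sphere_pos[where 'n = 'n, OF r[OF i]] by simp
  qed
  then show thesis
    using design by (intro that[of "?k 1" "?k 2"]) (auto simp: euclidean_design_def)
qed

section \<open>Consequences of the design identity\<close>

context
  fixes X :: "(real ^ 'n) set" and w :: "real ^ 'n \<Rightarrow> real"
    and Y :: "nat \<Rightarrow> (real ^ 'n) set" and r :: "nat \<Rightarrow> real"
  assumes design: "euclidean_design 4 X w Y r" and nz: "0 \<notin> X"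
begin

lemma design_facts:
  shows finite_X: "finite X" and w_pos: "\<And>u. u \<in> X \<Longrightarrow> w u > 0"
    and X_eq: "X = Y 1 \<union> Y 2" and disjoint: "Y 1 \<inter> Y 2 = {}"
    and r_neq: "r 1 \<noteq> r 2"
    and norm_1: "\<And>u. u \<in> Y 1 \<Longrightarrow> norm u = r 1" and norm_2: "\<And>u. u \<in> Y 2 \<Longrightarrow> norm u = r 2"
    and r_pos: "0 < r 1" "0 < r 2"
proof -
  show "finite X" and "\<And>u. u \<in> X \<Longrightarrow> w u > 0" and "X = Y 1 \<union> Y 2" and "Y 1 \<inter> Y 2 = {}"
    and "r 1 \<noteq> r 2"
    using design
    unfolding euclidean_design_def on_two_concentric_spheres_def weighted_finite_set_def by auto
  show 1: "\<And>u. u \<in> Y 1 \<Longrightarrow> norm u = r 1" and 2: "\<And>u. u \<in> Y 2 \<Longrightarrow> norm u = r 2"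
    using design unfolding euclidean_design_def on_two_concentric_spheres_def by auto
  have "Y i \<noteq> {}" "0 \<le> r i" "0 \<notin> Y i" if "i \<in> {1, 2}" for i
    using design nz that unfolding euclidean_design_def on_two_concentric_spheres_def by auto
  then show "0 < r 1" "0 < r 2"
    using 1 2 by (metis ex_in_conv insertCI norm_eq_zero order_le_less)+
qed

lemma poly_eq_0_of_design:
  assumes f: "poly_degree_le 2 f" and zero: "\<And>x. x \<in> X \<Longrightarrow> f x = 0"
    and x: "x \<in> sphere 0 (r 1) \<union> sphere 0 (r 2)"
  shows "f x = 0"
proof -
  have f4: "poly_degree_le 4 (\<lambda>x. f x * f x)"
    using poly_degree_le_mult[OF f f] by simp
  have cont: "continuous_on UNIV (\<lambda>x. f x * f x)"
    by (rule poly_degree_le_continuous[OF f4])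
  let ?I = "\<lambda>i. LINT x:sphere 0 (r i)|surface_measure (r i). f x * f x"
  have nn: "?I i \<ge> 0" for i
    unfolding set_lebesgue_integral_def by (intro integral_nonneg_AE) (auto simp: indicator_def)
  obtain k1 k2 where k: "k1 > 0" "k2 > 0"
    and id: "\<And>f. poly_degree_le 4 f \<Longrightarrow>
      k1 * (LINT x:sphere 0 (r 1)|surface_measure (r 1). f x)
      + k2 * (LINT x:sphere 0 (r 2)|surface_measure (r 2). f x) = (\<Sum>u\<in>X. w u * f u)"
    using design_sphere_integral[OF design nz] by blast
  \<comment> \<open>Both terms are nonnegative with positive coefficients, so each integral vanishes
    separately.\<close>
  have "k1 * ?I 1 + k2 * ?I 2 = 0"
    unfolding id[OF f4] using zero by (intro sum.neutral) auto
  then have "?I 1 = 0" "?I 2 = 0"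
    using k nn[of 1] nn[of 2] by (auto simp: add_nonneg_eq_0_iff)
  then have "f x * f x = 0"
    using x surface_integral_nonneg_eq_0D[OF r_pos(1) cont] surface_integral_nonneg_eq_0D[OF r_pos(2) cont]
    by (metis UnE zero_le_square)
  then show ?thesis by simp
qed

lemma dim_poly_space_bounds:
  shows "fun_vs.dim (poly_space_on 2 (sphere 0 (r 1) \<union> sphere 0 (r 2) :: (real ^ 'n) set)) \<le> card X"
    and "(CARD('n) + 2) choose 2 \<le>
      fun_vs.dim (poly_space_on 2 (sphere 0 (r 1) \<union> sphere 0 (r 2) :: (real ^ 'n) set))"
proof -
  let ?S = "sphere 0 (r 1) \<union> sphere 0 (r 2) :: (real ^ 'n) set"
  have XS: "X \<subseteq> ?S"
    using X_eq norm_1 norm_2 by auto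
  have det: "f = 0" if f: "f \<in> poly_space_on 2 ?S" and zero: "\<And>x. x \<in> X \<Longrightarrow> f x = 0" for f
  proof -
    obtain g where g: "poly_degree_le 2 g" "f = (\<lambda>x. if x \<in> ?S then g x else 0)"
      using f unfolding poly_space_on_def by auto
    have "g x = 0" if "x \<in> X" for x
      using zero[OF that] that XS g(2) by (auto split: if_splits)
    from poly_eq_0_of_design[OF g(1) this] show ?thesis
      using g(2) by (auto simp: fun_eq_iff)
  qed
  obtain I where I: "I \<subseteq> poly_space_on 2 ?S" "fun_vs.independent I" "card I = (CARD('n) + 2) choose 2"
    using poly_space_on_independent[OF r_pos r_neq] .
  note dim_bounds_of_determining_set[OF subspace_poly_space_on finite_X det I(1,2)]
  then show "fun_vs.dim (poly_space_on 2 ?S) \<le> card X"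
    and "(CARD('n) + 2) choose 2 \<le> fun_vs.dim (poly_space_on 2 ?S)"
    using I(3) by auto
qed

text \<open>The factor \<open>(norm x)\<^sup>2 - (r 2)\<^sup>2\<close> kills the second sphere, so the design identity for
  degree 4 becomes a quadrature rule of strength 2 on the first sphere alone.\<close>

lemma first_layer_quadrature:
  obtains k where "k > 0"
    "\<And>f. poly_degree_le 2 f \<Longrightarrow>
      k * (LINT x:sphere 0 (r 1)|surface_measure (r 1). f x) = (\<Sum>u\<in>Y 1. w u * f u)"
proof -
  obtain k1 k2 where k: "k1 > 0" "k2 > 0"
    and id: "\<And>f. poly_degree_le 4 f \<Longrightarrow>
      k1 * (LINT x:sphere 0 (r 1)|surface_measure (r 1). f x)
      + k2 * (LINT x:sphere 0 (r 2)|surface_measure (r 2). f x) = (\<Sum>u\<in>X. w u * f u)"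
    using design_sphere_integral[OF design nz] by blast
  \<comment> \<open>The constant value of the extra factor on the first sphere; it is nonzero and
    cancels at the end.\<close>
  let ?d = "(r 1)\<^sup>2 - (r 2)\<^sup>2"
  have d: "?d \<noteq> 0"
    using r_pos r_neq by (simp add: power2_eq_iff)
  have "k1 * (LINT x:sphere 0 (r 1)|surface_measure (r 1). f x) = (\<Sum>u\<in>Y 1. w u * f u)"
    if f: "poly_degree_le 2 f" for f
  proof -
    let ?g = "\<lambda>x. f x * ((norm x)\<^sup>2 - (r 2)\<^sup>2)"
    have "poly_degree_le 4 ?g"
      using poly_degree_le_mult[OF f poly_degree_le_norm_minus] by simp
    note id[OF this]
    moreover have "(LINT x:sphere 0 (r 1)|surface_measure (r 1). ?g x)
        = (LINT x:sphere 0 (r 1)|surface_measure (r 1). f x) * ?d"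
    proof -
      have "(\<lambda>x. indicator (sphere 0 (r 1)) x *\<^sub>R ?g x)
          = (\<lambda>x. (indicator (sphere 0 (r 1)) x *\<^sub>R f x) * ?d)"
        by (auto simp: indicator_def)
      then show ?thesis
        unfolding set_lebesgue_integral_def by (simp only: integral_mult_left_zero)
    qed
    moreover have "(LINT x:sphere 0 (r 2)|surface_measure (r 2). ?g x) = 0"
    proof -
      have "(\<lambda>x. indicator (sphere 0 (r 2)) x *\<^sub>R ?g x) = (\<lambda>x. 0)"
        by (auto simp: indicator_def)
      then show ?thesis
        unfolding set_lebesgue_integral_def by simp
    qed
    moreover have "(\<Sum>u\<in>X. w u * ?g u) = (\<Sum>u\<in>Y 1. w u * f u) * ?d"
    proof -
      have "(\<Sum>u\<in>X. w u * ?g u) = (\<Sum>u\<in>Y 1. w u * ?g u) + (\<Sum>u\<in>Y 2. w u * ?g u)"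
        using finite_X disjoint unfolding X_eq by (intro sum.union_disjoint) auto
      also have "(\<Sum>u\<in>Y 2. w u * ?g u) = 0"
        by (intro sum.neutral) (auto simp: norm_2)
      also have "(\<Sum>u\<in>Y 1. w u * ?g u) = (\<Sum>u\<in>Y 1. w u * f u) * ?d"
        unfolding sum_distrib_right by (intro sum.cong) (auto simp: norm_1)
      finally show ?thesis by simp
    qed
    ultimately show ?thesis using d by simp
  qed
  then show thesis by (rule that[OF k(1)])
qed

text \<open>Linear forms are odd, so their integrals over the first sphere vanish.\<close>

lemma first_layer_weighted_sum: "(\<Sum>u\<in>Y 1. w u *\<^sub>R u) = 0"
proof (rule vector_eq_ldot[THEN iffD1], intro allI)
  fix a :: "real ^ 'n"
  obtain k where "k > 0"
    and k: "\<And>f. poly_degree_le 2 f \<Longrightarrow>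
      k * (LINT x:sphere 0 (r 1)|surface_measure (r 1). f x) = (\<Sum>u\<in>Y 1. w u * f u)"
    using first_layer_quadrature by blast
  have "(LINT x:sphere 0 (r 1)|surface_measure (r 1). a \<bullet> x) = 0"
    by (rule set_integral_surface_odd[OF r_pos(1)]) (auto intro!: borel_measurable_continuous_onI continuous_intros)
  with k[OF poly_degree_le_inner, of a] show "a \<bullet> (\<Sum>u\<in>Y 1. w u *\<^sub>R u) = a \<bullet> 0"
    by (simp add: inner_sum_right)
qed

text \<open>If some \<open>a\<close> were orthogonal to the layer, the quadrature rule would make
  the square of \<open>a \<bullet> x\<close> integrate to 0, although it is positive at the point of
  the sphere in direction \<open>a\<close>.\<close>

lemma first_layer_span: "span (Y 1) = UNIV"
proof (rule ccontr)
  assume "span (Y 1) \<noteq> UNIV"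
  then obtain a where a: "a \<noteq> 0" "\<forall>x\<in>span (Y 1). a \<bullet> x = 0"
    using span_not_univ_subset_hyperplane by blast
  let ?f = "\<lambda>x. (a \<bullet> x) * (a \<bullet> x)"
  have "poly_degree_le (1 + 1) ?f"
    by (intro poly_degree_le_mult poly_degree_le_inner) simp_all
  then have f: "poly_degree_le 2 ?f"
    by (simp only: one_add_one)
  obtain k where "k > 0"
    and k: "\<And>f. poly_degree_le 2 f \<Longrightarrow>
      k * (LINT x:sphere 0 (r 1)|surface_measure (r 1). f x) = (\<Sum>u\<in>Y 1. w u * f u)"
    using first_layer_quadrature by blast
  have "(\<Sum>u\<in>Y 1. w u * ?f u) = 0"
    using a(2) by (intro sum.neutral) (auto intro: span_base)
  then have int: "(LINT x:sphere 0 (r 1)|surface_measure (r 1). ?f x) = 0"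
    using k[OF f] \<open>k > 0\<close> by simp
  have mem: "(r 1 / norm a) *\<^sub>R a \<in> sphere 0 (r 1)"
    using a(1) r_pos by simp
  have "?f ((r 1 / norm a) *\<^sub>R a) = 0"
    by (rule surface_integral_nonneg_eq_0D[where f = ?f,
          OF r_pos(1) poly_degree_le_continuous[OF f] zero_le_square int mem])
  then show False
    using a(1) r_pos by simp
qed

end

section \<open>Equality of the lower and upper bounds\<close>

theorem theorem4p1:
  fixes X :: "(real ^ 'n) set" and w :: "real ^ 'n \<Rightarrow> real"
    and Y :: "nat \<Rightarrow> (real ^ 'n) set" and r :: "nat \<Rightarrow> real"
  assumes "CARD('n) \<ge> 2"
    and "euclidean_design 4 X w Y r"
    and "0 \<notin> X"
    and "\<forall>i\<in>{1, 2}. w constant_on Y i"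
    and "\<forall>l\<in>{1, 2}. \<forall>m\<in>{1, 2}. card (angle_set Y r l m) \<le> 2"
    and "card (Y 1) = CARD('n) + 1"
  shows "tight_euclidean_4_design X w Y r"
proof -
  note facts = design_facts[OF assms(2,3)]
  have fin: "finite (Y 1)" "finite (Y 2)"
    using facts(1,3) by auto
  have sum: "(\<Sum>x\<in>Y 1. x) = 0"
  proof -
    obtain c where c: "\<And>x. x \<in> Y 1 \<Longrightarrow> w x = c"
      using assms(4) unfolding constant_on_def by auto
    have "Y 1 \<noteq> {}" using assms(6) by auto
    then have "c \<noteq> 0" using c facts(2,3) by fastforce
    moreover have "c *\<^sub>R (\<Sum>x\<in>Y 1. x) = 0"
      using first_layer_weighted_sum[OF assms(2,3)] c by (simp add: scaleR_sum_right)
    ultimately show ?thesis by simp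
  qed
  \<comment> \<open>An infinite set has \<open>card\<close> 0, so the bounds on angle sets say
    something only together with finiteness.\<close>
  have fin_angle: "finite (angle_set Y r l m)" if "l \<in> {1, 2}" "m \<in> {1, 2}" for l m
  proof (rule finite_subset)
    show "angle_set Y r l m \<subseteq> (\<lambda>(x, y). (x \<bullet> y) / (r l * r m)) ` (Y l \<times> Y m)"
      unfolding angle_set_def by auto
  qed (use that fin in auto)
  \<comment> \<open>For the mixed angles any value outside the set will do; only the pair
    \<open>g\<close>, \<open>h\<close> is wanted.\<close>
  obtain z where "z \<notin> angle_set Y r 1 2"
    using ex_new_if_finite[OF infinite_UNIV_char_0 fin_angle[of 1 2]] by auto
  then obtain g h where gh: "angle_set Y r 1 2 \<subseteq> {g, h}"
    using card_le_2_avoidingE fin_angle[of 1 2] assms(5) by (metis insertCI)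
  \<comment> \<open>Angle 1 would be equality in Cauchy-Schwarz for vectors of equal norm. Avoiding
    1 keeps the squared norm away from both inner products.\<close>
  have "1 \<notin> angle_set Y r 2 2"
  proof
    assume "1 \<in> angle_set Y r 2 2"
    then obtain x y where xy: "x \<in> Y 2" "y \<in> Y 2" "x \<noteq> y" "x \<bullet> y = r 2 * r 2"
      using facts(9) unfolding angle_set_def by (auto simp: field_simps)
    then have "x \<bullet> y = norm x * norm y" "norm x = norm y"
      using facts(7) by auto
    then show False
      using xy(3) norm_cauchy_schwarz_eq[of x y] facts(7)[OF xy(1)] facts(9) by auto
  qed
  then obtain a b where ab: "angle_set Y r 2 2 \<subseteq> {a, b}" "1 \<noteq> a" "1 \<noteq> b"
    using card_le_2_avoidingE fin_angle[of 2 2] assms(5) by (metis insertCI)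
  have "card (Y 2) \<le> card (Y 1) choose 2"
  \<comment> \<open>Angles are normalized, so the radii are multiplied back in.\<close>
  proof (rule card_two_distance_bound[where g = "g * (r 1 * r 2)" and h = "h * (r 1 * r 2)"
        and a = "a * (r 2 * r 2)" and b = "b * (r 2 * r 2)"])
    show "card (Y 1) \<ge> 3" using assms(1,6) by simp
    show "span (Y 1) = UNIV" by (rule first_layer_span[OF assms(2,3)])
  next
    fix x y assume xy: "x \<in> Y 1" "y \<in> Y 2"
    then have "(x \<bullet> y) / (r 1 * r 2) \<in> angle_set Y r 1 2"
      using facts(4) unfolding angle_set_def by blast
    then have "(x \<bullet> y) / (r 1 * r 2) \<in> {g, h}" using gh by blast
    then show "x \<bullet> y \<in> {g * (r 1 * r 2), h * (r 1 * r 2)}"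
      using facts(8,9) by auto
  next
    fix x y assume xy: "x \<in> Y 2" "y \<in> Y 2" "x \<noteq> y"
    then have "(x \<bullet> y) / (r 2 * r 2) \<in> angle_set Y r 2 2"
      unfolding angle_set_def by blast
    then have "(x \<bullet> y) / (r 2 * r 2) \<in> {a, b}" using ab(1) by blast
    then show "x \<bullet> y \<in> {a * (r 2 * r 2), b * (r 2 * r 2)}"
      using facts(9) by auto
  next
    fix x assume "x \<in> Y 2"
    then have "x \<bullet> x = r 2 * r 2"
      using facts(7)[of x] by (simp add: dot_square_norm power2_eq_square)
    then show "x \<bullet> x \<noteq> a * (r 2 * r 2) \<and> x \<bullet> x \<noteq> b * (r 2 * r 2)"
      using ab(2,3) facts(9) by auto
  qed (fact fin sum)+
  moreover have "card X = card (Y 1) + card (Y 2)"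
    unfolding facts(3) using fin facts(4) by (rule card_Un_disjoint)
  \<comment> \<open>Pascal's rule with \<open>card (Y 1) = CARD('n) + 1\<close>, that is,
    \<open>(CARD('n) + 1) choose 1\<close>.\<close>
  ultimately have "card X \<le> (CARD('n) + 2) choose 2"
    using assms(6) by (simp add: numeral_2_eq_2)
  then show ?thesis
    using dim_poly_space_bounds[OF assms(2,3)] assms(2)
    unfolding tight_euclidean_4_design_def by (simp add: Let_def)
qed

end
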